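(* Let $D$ be a source-free one-way break digraph on $n$ vertices with $V(D)=S\,\dot\cup\,T$, where $D[S]$ is acyclic, $D[T]$ is a tournament, and every arc between $S$ and $T$ is directed from $T$ to $S$. Then $D$ has a quasi-kernel $K$ with $|K|\le n/2$.
   Context: All digraphs are finite and loopless. A tournament is an orientation of a complete graph; a digraph is acyclic if it has no directed cycle; $D[X]$ denotes the subdigraph of $D$ induced by $X$. A digraph $D$ is a one-way break digraph if $V(D)$ has a partition $V(D)=S\,\dot\cup\,T$ such that $D[S]$ is acyclic, $D[T]$ is a tournament, and every arc between $S$ and $T$ is directed from $T$ to $S$. A vertex is a source if it has no in-neighbor; a digraph is source-free if it has no source. A set of vertices is independent if there is no arc between any two of its vertices. A quasi-kernel of a digraph $D$ is an independent set $K\subseteq V(D)$ such that every vertex of $D$ is reachable from some vertex of $K$ by a directed path of length at most $2$ (length $0$ allowed). *)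

theory Defs
  imports Complex_Main "Graph_Theory.Digraph_Component"
begin

definition acyclic_digraph :: "('a,'b) pre_digraph \<Rightarrow> bool" where
  "acyclic_digraph G \<longleftrightarrow> \<not> (\<exists>p. pre_digraph.cycle G p)"

text \<open>The locale \<^term>\<open>digraph\<close> excludes loops and parallel arcs but still permits a pair of
  opposite arcs; the inequality of truth values below asks for exactly one of the two arcs.\<close>

definition tournament :: "('a,'b) pre_digraph \<Rightarrow> bool" where
  "tournament G \<longleftrightarrow> digraph G \<and>
     (\<forall>u\<in>verts G. \<forall>v\<in>verts G. u \<noteq> v \<longrightarrow> (u \<rightarrow>\<^bsub>G\<^esub> v) \<noteq> (v \<rightarrow>\<^bsub>G\<^esub> u))"

text \<open>Either part of the partition may be empty.\<close>

definition one_way_break :: "('a,'b) pre_digraph \<Rightarrow> 'a set \<Rightarrow> 'a set \<Rightarrow> bool" where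
  "one_way_break G S T \<longleftrightarrow>
     verts G = S \<union> T \<and> S \<inter> T = {} \<and>
     acyclic_digraph (G \<restriction> S) \<and> tournament (G \<restriction> T) \<and>
     (\<forall>e\<in>arcs G. (tail G e \<in> S \<and> head G e \<in> T) \<or> (tail G e \<in> T \<and> head G e \<in> S)
        \<longrightarrow> tail G e \<in> T \<and> head G e \<in> S)"

definition is_source :: "('a,'b) pre_digraph \<Rightarrow> 'a \<Rightarrow> bool" where
  "is_source G v \<longleftrightarrow> v \<in> verts G \<and> \<not> (\<exists>u. u \<rightarrow>\<^bsub>G\<^esub> v)"

definition source_free :: "('a,'b) pre_digraph \<Rightarrow> bool" where
  "source_free G \<longleftrightarrow> \<not> (\<exists>v. is_source G v)"

definition independent_verts :: "('a,'b) pre_digraph \<Rightarrow> 'a set \<Rightarrow> bool" where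
  "independent_verts G K \<longleftrightarrow> K \<subseteq> verts G \<and> (\<forall>u\<in>K. \<forall>v\<in>K. \<not> (u \<rightarrow>\<^bsub>G\<^esub> v))"

definition quasi_kernel :: "('a,'b) pre_digraph \<Rightarrow> 'a set \<Rightarrow> bool" where
  "quasi_kernel G K \<longleftrightarrow> independent_verts G K \<and>
     (\<forall>v\<in>verts G. \<exists>u\<in>K. \<exists>p. pre_digraph.apath G u p v \<and> length p \<le> 2)"

end

theory Submission
  imports Defs
begin

text \<open>Let \<open>I\<close> be the set of sources of \<open>D[S]\<close> and match a subset \<open>J\<close> of \<open>I\<close> injectively into
  out-neighbours in \<open>S\<close>, with \<open>J\<close> inclusion-maximal. Every vertex of \<open>I - J\<close> has an in-neighbour in
  \<open>T\<close>; these induce weights on \<open>T\<close>, and a vertex \<open>t\<close> whose closed out-neighbourhood in \<open>T\<close> has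
  maximal weight (ties broken by its cardinality) reaches all of \<open>T\<close> and at least half of \<open>I - J\<close>
  within two steps. Let \<open>Z\<close> be the rest of \<open>I - J\<close>, \<open>A\<close> the out-neighbourhood of \<open>t\<close> in \<open>S\<close> and
  \<open>F = (J - A) \<union> Z\<close>. Take a kernel \<open>K\<^sub>1\<close> of the vertices of \<open>S - I - A\<close> that \<open>F\<close> does not dominate,
  and a kernel \<open>K\<^sub>2\<close> of what remains of these after deleting \<open>K\<^sub>1\<close>. Both \<open>{t} \<union> F \<union> K\<^sub>i\<close> are
  quasi-kernels: maximality of \<open>J\<close> makes the in-neighbours of \<open>K\<^sub>1\<close> harmless. As every element of
  \<open>J - A\<close> is paid for by its partner and every element of \<open>Z\<close> by one of \<open>I - J - Z\<close>, the
  smaller one has at most \<open>1 + |S| / 2\<close> elements, and \<open>|T| \<ge> 2\<close>.\<close>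

section \<open>Kernels of acyclic relations and maximal matchings\<close>

definition rel_independent :: "'a rel \<Rightarrow> 'a set \<Rightarrow> bool" where
  "rel_independent E K \<longleftrightarrow> (\<forall>u\<in>K. \<forall>v\<in>K. (u, v) \<notin> E)"

text \<open>Radius-two out-ball, phrased with walks; \<open>near_imp_short_apath\<close> later
  supplies the paths.\<close>

definition near :: "'a rel \<Rightarrow> 'a \<Rightarrow> 'a set" where
  "near E u = {v. u = v \<or> (u, v) \<in> E \<or> (\<exists>w. (u, w) \<in> E \<and> (w, v) \<in> E)}"

lemma acyclic_source_exists:
  assumes "finite X" and "X \<noteq> {}" and "acyclic (Restr E X)"
  obtains x where "x \<in> X" and "\<And>u. u \<in> X \<Longrightarrow> (u, x) \<notin> E"
proof -
  have wf: "wf (Restr E X)" using assms(1,3) by (intro finite_acyclic_wf) auto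
  obtain x where x: "x \<in> X" "\<And>u. (u, x) \<in> Restr E X \<Longrightarrow> u \<notin> X"
    by (rule wfE_min'[OF wf assms(2)]) (rule that)
  show thesis
    by (rule that[OF x(1)]) (use x in blast)
qed

text \<open>Greedy: a source \<open>x\<close> of \<open>X\<close> joins a kernel of what is left
  after deleting \<open>x\<close> and its out-neighbours. No arc enters \<open>x\<close> from
  \<open>X\<close>, and none leads from \<open>x\<close> to the rest.\<close>

lemma acyclic_kernel_exists:
  assumes "finite X" and "acyclic (Restr E X)"
  shows "\<exists>K\<subseteq>X. rel_independent E K \<and> X - K \<subseteq> E `` K"
  using assms
proof (induction X rule: finite_psubset_induct)
  case (psubset X)
  show ?case
  proof (cases "X = {}")
    case True
    then show ?thesis by (auto simp: rel_independent_def)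
  next
    case False
    obtain x where x: "x \<in> X" and src: "\<And>u. u \<in> X \<Longrightarrow> (u, x) \<notin> E"
      using acyclic_source_exists[OF psubset.hyps False psubset.prems] by blast
    let ?Y = "X - {x} - E `` {x}"
    have "acyclic (Restr E ?Y)"
      by (rule acyclic_subset[OF psubset.prems]) auto
    then obtain K where K: "K \<subseteq> ?Y" "rel_independent E K" "?Y - K \<subseteq> E `` K"
      using psubset.IH[of ?Y] x by blast
    have "rel_independent E (insert x K)"
      using K(1,2) x src by (auto simp: rel_independent_def)
    then show ?thesis
      using K(1,3) x by (intro exI[of _ "insert x K"]) auto
  qed
qed

text \<open>Elements are inserted one by one and matched whenever a candidate is free. The set of
  used partners only grows, so a blocked element stays blocked.\<close>

lemma maximal_matching_exists:
  assumes "finite I"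
  shows "\<exists>J m. J \<subseteq> I \<and> inj_on m J \<and> (\<forall>j\<in>J. m j \<in> N j) \<and> (\<forall>i\<in>I - J. N i \<subseteq> m ` J)"
  using assms
proof (induction I)
  case empty
  then show ?case by auto
next
  case (insert i I)
  then obtain J m where m: "J \<subseteq> I" "inj_on m J" "\<forall>j\<in>J. m j \<in> N j" "\<forall>i\<in>I - J. N i \<subseteq> m ` J"
    by blast
  show ?case
  proof (cases "N i \<subseteq> m ` J")
    case True
    then show ?thesis using m by (intro exI[of _ J] exI[of _ m]) auto
  next
    case False
    then obtain v where v: "v \<in> N i" "v \<notin> m ` J" by blast
    have i: "i \<notin> J" using m(1) insert.hyps by blast
    have im: "m(i := v) ` insert i J = insert v (m ` J)"
      using i by auto
    have "inj_on (m(i := v)) (insert i J)"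
      using m(2) v(2) i by (auto simp: inj_on_def)
    moreover have "\<forall>j\<in>insert i J. (m(i := v)) j \<in> N j"
      using m(3) v(1) i by auto
    moreover have "\<forall>k\<in>insert i I - insert i J. N k \<subseteq> m(i := v) ` insert i J"
      unfolding im using m(4) by blast
    ultimately show ?thesis
      using m(1) by (intro exI[of _ "insert i J"] exI[of _ "m(i := v)"]) blast
  qed
qed

section \<open>Heavy kings in tournaments\<close>

lemma heavy_vertex_exists:
  assumes "finite I" and "T \<noteq> {}" and f: "f ` I \<subseteq> T"
    and semi: "\<And>u v. u \<in> T \<Longrightarrow> v \<in> T \<Longrightarrow> u \<noteq> v \<Longrightarrow> (u, v) \<in> E \<or> (v, u) \<in> E"
  shows "\<exists>t\<in>T. card I \<le> 2 * card {i \<in> I. f i = t \<or> (t, f i) \<in> E}"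
proof (cases "I = {}")
  case True
  then show ?thesis using \<open>T \<noteq> {}\<close> by auto
next
  case False
  let ?W = "\<lambda>t. {i \<in> I. f i = t \<or> (t, f i) \<in> E}"
  \<comment> \<open>Double count: one of \<open>(i, j)\<close> and \<open>(j, i)\<close> always lies
    in \<open>?P\<close>, so on average over \<open>i\<close> the set \<open>?W (f i)\<close> has at
    least half the size of \<open>I\<close>.\<close>
  let ?P = "Sigma I (\<lambda>i. ?W (f i))"
  show ?thesis
  proof (rule ccontr)
    assume neg: "\<not> ?thesis"
    have fin: "finite ?P" using assms(1) by auto
    have "I \<times> I \<subseteq> ?P \<union> ?P\<inverse>"
    proof (rule subrelI)
      fix i j assume "(i, j) \<in> I \<times> I"
      then show "(i, j) \<in> ?P \<union> ?P\<inverse>" using semi[of "f i" "f j"] f by auto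
    qed
    then have "card (I \<times> I) \<le> card (?P \<union> ?P\<inverse>)"
      using fin by (intro card_mono) auto
    also have "\<dots> \<le> card ?P + card (?P\<inverse>)" by (rule card_Un_le)
    also have "\<dots> = 2 * card ?P" by (simp add: card_inverse)
    also have "\<dots> = (\<Sum>i\<in>I. 2 * card (?W (f i)))"
      using assms(1) by (simp add: sum_distrib_left)
    also have "\<dots> < (\<Sum>i\<in>I. card I)"
      using neg f False assms(1) by (intro sum_strict_mono) (auto simp: not_le)
    finally show False by (simp add: card_cartesian_product)
  qed
qed

text \<open>A vertex \<open>u\<close> that \<open>t\<close> does not reach in two steps dominates
  \<open>t\<close> and its out-neighbours in \<open>T\<close>, so \<open>N u\<close> properly
  contains \<open>N t\<close>. The additional vertices may carry no weight, hence the tie-break by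
  cardinality.\<close>

lemma heavy_king_exists:
  assumes "finite I" and "finite T" and "T \<noteq> {}" and f: "f ` I \<subseteq> T"
    and semi: "\<And>u v. u \<in> T \<Longrightarrow> v \<in> T \<Longrightarrow> u \<noteq> v \<Longrightarrow> (u, v) \<in> E \<or> (v, u) \<in> E"
  shows "\<exists>t\<in>T. T \<subseteq> near E t \<and> card I \<le> 2 * card {i \<in> I. f i = t \<or> (t, f i) \<in> E}"
proof -
  define N where "N t = {u \<in> T. u = t \<or> (t, u) \<in> E}" for t
  define W where "W t = {i \<in> I. f i \<in> N t}" for t
  \<comment> \<open>Lexicographic order in a single number: \<open>card (N t)\<close> stays below
    the factor \<open>card T + 1\<close>.\<close>
  define g where "g t = card (W t) * (card T + 1) + card (N t)" for t
  have W_eq: "W t = {i \<in> I. f i = t \<or> (t, f i) \<in> E}" for t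
    using f by (auto simp: W_def N_def)
  have finN: "finite (N t)" and N_le: "card (N t) \<le> card T" for t
    using assms(2) by (auto simp: N_def intro: card_mono)
  have finW: "finite (W t)" for t
    using assms(1) by (simp add: W_def)
  obtain t where t: "t \<in> T" and max: "\<And>u. u \<in> T \<Longrightarrow> g u \<le> g t"
  proof -
    have "Max (g ` T) \<in> g ` T" using assms(2,3) by (intro Max_in) auto
    then obtain t where "t \<in> T" "g t = Max (g ` T)" by auto
    then show thesis using that assms(2) by simp
  qed
  obtain s where s: "s \<in> T" "card I \<le> 2 * card (W s)"
    using heavy_vertex_exists[OF assms(1,3) f semi] unfolding W_eq by blast
  have "card (W s) \<le> card (W t)"
  proof (rule ccontr)
    assume "\<not> ?thesis"
    then have "(card (W t) + 1) * (card T + 1) \<le> card (W s) * (card T + 1)"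
      by (intro mult_right_mono) auto
    then have "g t < g s" using N_le[of t] by (simp add: g_def)
    then show False using max[OF s(1)] by simp
  qed
  moreover have "T \<subseteq> near E t"
  proof
    fix u assume u: "u \<in> T"
    show "u \<in> near E t"
    proof (rule ccontr)
      assume far: "u \<notin> near E t"
      then have "N t \<subseteq> N u"
        using semi[OF u] by (auto simp: N_def near_def)
      moreover have "u \<in> N u" "u \<notin> N t"
        using far u by (auto simp: N_def near_def)
      ultimately have sub: "N t \<subset> N u" by blast
      then have "card (N t) < card (N u)" using finN by (intro psubset_card_mono)
      moreover have "card (W t) \<le> card (W u)"
        using sub finW by (intro card_mono) (auto simp: W_def)
      then have "card (W t) * (card T + 1) \<le> card (W u) * (card T + 1)"
        by (rule mult_right_mono) simp
      ultimately have "g t < g u" by (simp add: g_def)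
      then show False using max[OF u] by simp
    qed
  qed
  ultimately show ?thesis using s(2) t unfolding W_eq by (intro bexI[of _ t]) auto
qed

section \<open>Covering the acyclic part\<close>

text \<open>\<open>A\<close> and \<open>C\<close> stand for the vertices at distance one and at distance at most two from a
  vertex outside \<open>S\<close>.\<close>

lemma acyclic_small_cover:
  assumes "finite S" and acyc: "acyclic (Restr E S)"
    and AC: "A \<subseteq> C" "E `` A \<inter> S \<subseteq> C"
    and I: "I = {v \<in> S. \<forall>u\<in>S. (u, v) \<notin> E}"
    and J: "J \<subseteq> I" "inj_on m J" "\<And>j. j \<in> J \<Longrightarrow> m j \<in> E `` {j} \<inter> S"
    and max: "\<And>i. i \<in> I - J \<Longrightarrow> E `` {i} \<inter> S \<subseteq> m ` J"
    and half: "card (I - J) \<le> 2 * card ((I - J) \<inter> C)"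
  shows "\<exists>Q\<subseteq>S - A. rel_independent E Q \<and> S - C \<subseteq> (\<Union>u\<in>Q. near E u) \<and> 2 * card Q \<le> card S"
proof -
  define Z where "Z = I - J - C"
  define F where "F = (J - A) \<union> Z"
  define X where "X = S - I - A - E `` F"
  have IS: "I \<subseteq> S" and finI: "finite I" using I assms(1) by auto
  have finX: "finite X" using assms(1) by (simp add: X_def)
  have ker: "\<exists>K\<subseteq>Y. rel_independent E K \<and> Y - K \<subseteq> E `` K" if "Y \<subseteq> X" for Y
  proof (rule acyclic_kernel_exists)
    show "finite Y" using that finX finite_subset by blast
    show "acyclic (Restr E Y)" using that by (intro acyclic_subset[OF acyc]) (auto simp: X_def)
  qed
  obtain K1 where K1: "K1 \<subseteq> X" "rel_independent E K1" "X - K1 \<subseteq> E `` K1"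
    using ker[of X] by blast
  obtain K2 where K2: "K2 \<subseteq> X - K1" "rel_independent E K2" "X - K1 - K2 \<subseteq> E `` K2"
    using ker[of "X - K1"] by blast
  have sub: "F \<union> K \<subseteq> S - A" if "K \<subseteq> X" for K
    using that IS J(1) AC(1) by (auto simp: F_def Z_def X_def)
  have FI: "F \<subseteq> I" using J(1) by (auto simp: F_def Z_def)
  have ind: "rel_independent E (F \<union> K)" if K: "K \<subseteq> X" "rel_independent E K" for K
  proof -
    have "F \<union> K \<subseteq> S" using sub[OF K(1)] by blast
    then have "(u, v) \<notin> E" if "u \<in> F \<union> K" "v \<in> F" for u v
      using that FI I by blast
    moreover have "(u, v) \<notin> E" if "u \<in> F" "v \<in> K" for u v
      using that K(1) by (auto simp: X_def)
    ultimately show ?thesis using K(2) unfolding rel_independent_def by blast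
  qed
  \<comment> \<open>Vertices of \<open>I\<close> outside \<open>C\<close> lie in \<open>F\<close>;
    any other vertex of \<open>S\<close> outside \<open>C\<close> and \<open>X\<close> is dominated
    by \<open>F\<close>.\<close>
  have cov_rest: "v \<in> (\<Union>u\<in>F \<union> K. near E u)" if "v \<in> S - C - X" for v K
  proof -
    have "v \<in> F \<or> v \<in> E `` F" using that AC(1) by (auto simp: X_def F_def Z_def)
    then show ?thesis by (auto simp: near_def)
  qed
  have cov1: "S - C \<subseteq> (\<Union>u\<in>F \<union> K1. near E u)"
  proof
    fix v assume v: "v \<in> S - C"
    show "v \<in> (\<Union>u\<in>F \<union> K1. near E u)"
    proof (cases "v \<in> X")
      case True
      then have "v \<in> K1 \<or> v \<in> E `` K1" using K1(3) by blast
      then show ?thesis by (auto simp: near_def)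
    qed (use v cov_rest in blast)
  qed
  have cov2: "S - C \<subseteq> (\<Union>u\<in>F \<union> K2. near E u)"
  proof
    fix v assume v: "v \<in> S - C"
    consider "v \<notin> X" | "v \<in> X - K1" | "v \<in> K1" using K1(1) by blast
    then show "v \<in> (\<Union>u\<in>F \<union> K2. near E u)"
    proof cases
      case 1
      then show ?thesis using v cov_rest by blast
    next
      case 2
      then have "v \<in> K2 \<or> v \<in> E `` K2" using K2(3) by blast
      then show ?thesis by (auto simp: near_def)
    next
      \<comment> \<open>\<open>K2\<close> need not dominate \<open>K1\<close>, so \<open>v\<close>
        is reached through an in-neighbour \<open>u\<close> that lies in
        \<open>F \<union> K2\<close> or is dominated by it.\<close>
      case 3
      then have vX: "v \<in> X" using K1(1) by blast
      then obtain u where u: "u \<in> S" "(u, v) \<in> E" using I by (auto simp: X_def)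
      have uF: "u \<notin> F" using vX u(2) by (auto simp: X_def)
      have uA: "u \<notin> A" using AC(2) u(2) v by blast
      \<comment> \<open>Otherwise \<open>u\<close> is unmatched, and maximality gives
        \<open>v\<close> a partner \<open>j\<close>. If \<open>j\<close> is in \<open>A\<close>,
        then \<open>v\<close> is in \<open>C\<close>; if not, \<open>j\<close> is in
        \<open>F\<close> and dominates \<open>v\<close>, which contradicts
        \<open>v \<in> X\<close>.\<close>
      have "u \<notin> I"
      proof
        assume "u \<in> I"
        then have "u \<in> I - J" using uF uA by (auto simp: F_def)
        then obtain j where j: "j \<in> J" "v = m j" using max u(2) v by blast
        then have "(j, v) \<in> E" using J(3) by auto
        then show False using j(1) vX v AC(2) by (auto simp: X_def F_def)
      qed
      moreover have "u \<notin> K1" using K1(2) u(2) 3 by (auto simp: rel_independent_def)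
      ultimately have "u \<in> F \<union> K2 \<or> u \<in> E `` (F \<union> K2)"
        using u(1) uA K2(3) by (auto simp: X_def)
      then show ?thesis using u(2) by (auto simp: near_def)
    qed
  qed
  have "card (I - J) = card Z + card ((I - J) \<inter> C)"
    using card_Int_Diff[of "I - J" C] finI by (simp add: Z_def add.commute)
  then have cZ: "2 * card Z \<le> card (I - J)" using half by linarith
  have "card (J - A) \<le> card J" using finI J(1) by (intro card_mono) (auto intro: finite_subset)
  moreover have "card I = card J + card (I - J)"
    using finI J(1) by (metis card_Diff_subset card_mono finite_subset le_add_diff_inverse)
  ultimately have cI: "card (J - A) + 2 * card Z \<le> card I" using cZ by linarith
  \<comment> \<open>This makes \<open>I\<close>, the partners of \<open>J - A\<close> and
    \<open>X\<close> pairwise disjoint in \<open>S\<close>: partners have an in-neighbour in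
    \<open>S\<close> and are dominated by \<open>F\<close>.\<close>
  have mJ: "m ` (J - A) \<subseteq> (E `` F \<inter> S) - I"
  proof
    fix v assume "v \<in> m ` (J - A)"
    then obtain j where j: "j \<in> J - A" "v = m j" by blast
    then have v: "(j, v) \<in> E" "v \<in> S" using J(3)[of j] by auto
    moreover have "j \<in> F" "j \<in> S" using j(1) J(1) IS by (auto simp: F_def)
    ultimately show "v \<in> (E `` F \<inter> S) - I" using I by blast
  qed
  have "card I + card (m ` (J - A)) + card X = card (I \<union> m ` (J - A) \<union> X)"
  proof -
    have "finite (m ` (J - A))" using finI J(1) finite_subset by blast
    moreover have "I \<inter> m ` (J - A) = {}" "(I \<union> m ` (J - A)) \<inter> X = {}"
      using mJ by (auto simp: X_def)
    ultimately show ?thesis using finI finX by (simp add: card_Un_disjoint)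
  qed
  also have "\<dots> \<le> card S"
    using assms(1) IS mJ by (intro card_mono) (auto simp: X_def)
  finally have "card I + card (J - A) + card X \<le> card S"
    using J(2) by (simp add: card_image inj_on_diff)
  moreover have "card F \<le> card (J - A) + card Z" unfolding F_def by (rule card_Un_le)
  moreover have "card K1 + card K2 \<le> card X"
  proof -
    have "card K1 + card K2 = card (K1 \<union> K2)"
      using K1(1) K2(1) finX by (intro card_Un_disjoint[symmetric]) (auto intro: finite_subset)
    also have "\<dots> \<le> card X" using K1(1) K2(1) finX by (intro card_mono) auto
    finally show ?thesis .
  qed
  moreover have "card (F \<union> K1) \<le> card F + card K1" "card (F \<union> K2) \<le> card F + card K2"
    by (rule card_Un_le)+
  \<comment> \<open>The two cardinalities sum to at most
    \<open>2 * card (J - A) + 2 * card Z + card X\<close>, which is at most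
    \<open>card I + card (J - A) + card X\<close>, hence at most \<open>card S\<close>.\<close>
  ultimately have "2 * card (F \<union> K1) \<le> card S \<or> 2 * card (F \<union> K2) \<le> card S"
    using cI by linarith
  moreover have "K2 \<subseteq> X" using K2(1) by blast
  ultimately show ?thesis
    using sub ind K1(1,2) K2(2) cov1 cov2 by metis
qed

lemma one_way_break_small_quasi_kernel:
  assumes fin: "finite S" "finite T" and disj: "S \<inter> T = {}"
    and acyc: "acyclic (Restr E S)"
    and semi: "\<And>u v. u \<in> T \<Longrightarrow> v \<in> T \<Longrightarrow> u \<noteq> v \<Longrightarrow> (u, v) \<in> E \<or> (v, u) \<in> E"
    and oneway: "\<And>u v. u \<in> S \<Longrightarrow> v \<in> T \<Longrightarrow> (u, v) \<notin> E"
    and irr: "irrefl E"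
    and src: "\<And>v. v \<in> S \<union> T \<Longrightarrow> \<exists>u\<in>S \<union> T. (u, v) \<in> E"
  shows "\<exists>Q\<subseteq>S \<union> T. rel_independent E Q \<and> S \<union> T \<subseteq> (\<Union>u\<in>Q. near E u) \<and> 2 * card Q \<le> card (S \<union> T)"
proof (cases "S \<union> T = {}")
  case True
  then show ?thesis by (auto simp: rel_independent_def)
next
  case False
  define I where "I = {v \<in> S. \<forall>u\<in>S. (u, v) \<notin> E}"
  have finI: "finite I" using fin by (simp add: I_def)
  have "T \<noteq> {}"
  proof
    assume T: "T = {}"
    then have "S \<noteq> {}" using False by simp
    then obtain x where "x \<in> S" "\<And>u. u \<in> S \<Longrightarrow> (u, x) \<notin> E"
      using acyclic_source_exists[OF fin(1) _ acyc] by blast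
    then show False using src[of x] T by auto
  qed
  obtain J m where m: "J \<subseteq> I" "inj_on m J" "\<forall>j\<in>J. m j \<in> E `` {j} \<inter> S"
      "\<forall>i\<in>I - J. E `` {i} \<inter> S \<subseteq> m ` J"
    using maximal_matching_exists[OF finI, of "\<lambda>i. E `` {i} \<inter> S"] by blast
  \<comment> \<open>A source of the part on \<open>S\<close> is no source of the whole, so it has an
    in-neighbour in \<open>T\<close>; \<open>f\<close> picks one and thus weights
    \<open>T\<close>.\<close>
  have "\<forall>i\<in>I. \<exists>u\<in>T. (u, i) \<in> E" using src by (fastforce simp: I_def)
  then obtain f where f: "\<And>i. i \<in> I \<Longrightarrow> f i \<in> T \<and> (f i, i) \<in> E" by metis
  have fT: "f ` (I - J) \<subseteq> T" using f by auto
  obtain t where t: "t \<in> T" "T \<subseteq> near E t"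
      "card (I - J) \<le> 2 * card {i \<in> I - J. f i = t \<or> (t, f i) \<in> E}"
    using heavy_king_exists[OF _ fin(2) \<open>T \<noteq> {}\<close> fT semi] finI by blast
  let ?C = "near E t" and ?A = "E `` {t}"
  have "card {i \<in> I - J. f i = t \<or> (t, f i) \<in> E} \<le> card ((I - J) \<inter> ?C)"
    using finI f by (intro card_mono) (auto simp: near_def)
  then have half: "card (I - J) \<le> 2 * card ((I - J) \<inter> ?C)" using t(3) by linarith
  have AC: "?A \<subseteq> ?C" "E `` ?A \<inter> S \<subseteq> ?C" by (auto simp: near_def)
  obtain Q where Q: "Q \<subseteq> S - ?A" "rel_independent E Q" "S - ?C \<subseteq> (\<Union>u\<in>Q. near E u)"
      "2 * card Q \<le> card S"
    using acyclic_small_cover[OF fin(1) acyc AC I_def m(1,2) _ _ half] m(3,4) by blast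
  have "rel_independent E (insert t Q)"
    using Q(1,2) oneway t(1) irr by (auto simp: rel_independent_def irrefl_def)
  moreover have "S \<union> T \<subseteq> (\<Union>u\<in>insert t Q. near E u)" using Q(3) t(2) by auto
  moreover have "2 * card (insert t Q) \<le> card (S \<union> T)"
  proof -
    \<comment> \<open>The in-neighbour of \<open>t\<close> cannot lie in \<open>S\<close>; this
      second vertex of \<open>T\<close> pays for adding \<open>t\<close>.\<close>
    obtain u where u: "u \<in> T" "(u, t) \<in> E" using src[of t] t(1) oneway by blast
    then have "u \<noteq> t" using irr by (auto simp: irrefl_def)
    then have "2 \<le> card T" using card_mono[OF fin(2), of "{u, t}"] u(1) t(1) by auto
    moreover have "card (S \<union> T) = card S + card T" using fin disj by (rule card_Un_disjoint)
    moreover have "card (insert t Q) \<le> card Q + 1" by (simp add: card_insert_le_m1 card_insert_if)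
    ultimately show ?thesis using Q(4) by linarith
  qed
  ultimately show ?thesis using Q(1) t(1) by (intro exI[of _ "insert t Q"]) auto
qed

section \<open>From relations back to digraphs\<close>

lemma arcs_ends_induce_subgraph: "arcs_ends (G \<restriction> X) = Restr (arcs_ends G) X"
  by (auto simp: arcs_ends_def arc_to_ends_def)

lemma (in wf_digraph) acyclic_digraph_imp_acyclic:
  assumes "acyclic_digraph G"
  shows "acyclic (arcs_ends G)"
proof (rule acyclicI, rule allI, rule notI)
  fix v assume "(v, v) \<in> (arcs_ends G)\<^sup>+"
  then obtain p where "awalk v p v" "p \<noteq> []" using reachable1_awalk by blast
  then have "closed_w p" by (auto simp: closed_w_def)
  then show False using closed_w_imp_cycle assms by (auto simp: acyclic_digraph_def)
qed

lemma (in loopfree_digraph) near_imp_short_apath: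
  assumes "v \<in> near (arcs_ends G) u" and "v \<in> verts G"
  shows "\<exists>p. apath u p v \<and> length p \<le> 2"
proof -
  consider "u = v" | "u \<noteq> v" "(u, v) \<in> arcs_ends G"
    | w where "u \<noteq> v" "(u, w) \<in> arcs_ends G" "(w, v) \<in> arcs_ends G"
    using assms(1) by (auto simp: near_def)
  then show ?thesis
  proof cases
    case 1
    then show ?thesis using assms(2) by (intro exI[of _ "[]"]) (auto simp: apath_simps)
  next
    case 2
    then obtain e where "e \<in> arcs G" "tail G e = u" "head G e = v"
      by (auto simp: arcs_ends_def arc_to_ends_def)
    then show ?thesis using 2 by (intro exI[of _ "[e]"]) (auto simp: apath_simps)
  next
    case 3
    then obtain e e' where "e \<in> arcs G" "tail G e = u" "head G e = w"
      "e' \<in> arcs G" "tail G e' = w" "head G e' = v"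
      by (auto simp: arcs_ends_def arc_to_ends_def)
    \<comment> \<open>Absence of loops makes \<open>w\<close> distinct from \<open>u\<close> and
      \<open>v\<close>, so the walk is a path.\<close>
    then show ?thesis using 3 no_loops
      by (intro exI[of _ "[e, e']"]) (auto simp: apath_simps)
  qed
qed

theorem theorem5p2:
  fixes G :: "('a,'b) pre_digraph" and S T :: "'a set" and n :: nat
  assumes "digraph G"
    and "card (verts G) = n"
    and "one_way_break G S T"
    and "source_free G"
  shows "\<exists>K. quasi_kernel G K \<and> real (card K) \<le> real n / 2"
proof -
  interpret digraph G by fact
  let ?E = "arcs_ends G"
  have V: "verts G = S \<union> T" and disj: "S \<inter> T = {}"
    and acyc: "acyclic_digraph (G \<restriction> S)" and tour: "tournament (G \<restriction> T)"
    and oneway: "\<And>e. e \<in> arcs G \<Longrightarrow> tail G e \<in> S \<Longrightarrow> head G e \<in> T \<Longrightarrow> tail G e \<in> T"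
    using assms(3) by (auto simp: one_way_break_def)
  have fin: "finite S" "finite T" using finite_verts V by auto
  have "wf_digraph (G \<restriction> S)" by (rule wellformed_induce_subgraph)
  from wf_digraph.acyclic_digraph_imp_acyclic[OF this acyc]
  have ac: "acyclic (Restr ?E S)" by (simp add: arcs_ends_induce_subgraph)
  have semi: "(u, v) \<in> ?E \<or> (v, u) \<in> ?E" if "u \<in> T" "v \<in> T" "u \<noteq> v" for u v
  proof -
    have "(u \<rightarrow>\<^bsub>G \<restriction> T\<^esub> v) \<noteq> (v \<rightarrow>\<^bsub>G \<restriction> T\<^esub> u)"
      using tour that unfolding tournament_def induce_subgraph_verts by blast
    then show ?thesis unfolding arcs_ends_induce_subgraph by blast
  qed
  have ow: "(u, v) \<notin> ?E" if "u \<in> S" "v \<in> T" for u v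
    using oneway that disj by (auto simp: arcs_ends_def arc_to_ends_def)
  have irr: "irrefl ?E"
    using no_loops by (auto simp: irrefl_def arcs_ends_def arc_to_ends_def)
  have src: "\<exists>u\<in>S \<union> T. (u, v) \<in> ?E" if "v \<in> S \<union> T" for v
  proof -
    have "\<not> is_source G v" using assms(4) by (simp add: source_free_def)
    moreover have "v \<in> verts G" using that V by simp
    ultimately obtain u where u: "(u, v) \<in> ?E" by (auto simp only: is_source_def)
    then have "u \<in> S \<union> T" using adj_in_verts(1)[OF u] V by simp
    with u show ?thesis by (rule bexI)
  qed
  obtain Q where Q: "Q \<subseteq> S \<union> T" "rel_independent ?E Q" "S \<union> T \<subseteq> (\<Union>u\<in>Q. near ?E u)"
      "2 * card Q \<le> card (S \<union> T)"
    using one_way_break_small_quasi_kernel[OF fin disj ac semi ow irr src] by blast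
  have "\<exists>u\<in>Q. \<exists>p. apath u p v \<and> length p \<le> 2" if "v \<in> verts G" for v
    using Q(3) V that near_imp_short_apath by blast
  then have "quasi_kernel G Q"
    using Q(1,2) V by (simp add: quasi_kernel_def independent_verts_def rel_independent_def)
  then show ?thesis using Q(4) V assms(2) by (intro exI[of _ Q]) auto
qed

end
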